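(* Let $f$ be a nonconstant meromorphic function on a domain $D\subset\mathbb{C}$, and let $S_n[f]$ denote Tamanoi's Schwarzian derivative of virtual order $n$ of $f$ ($n\ge 0$). Then for every integer $n\ge3$, $$ S_{n}[f] =S_{n-1}[f]'+\tfrac12 S_2[f]\sum_{k=1}^{n-1} \binom{n}{k}S_{k-1}[f]\, S_{n-k-1}[f] $$ at every point of $D$ where $f$ is locally univalent, where $S_{n-1}[f]'$ is the derivative of $S_{n-1}[f](z)$ with respect to $z$.
   Context: Tamanoi's Schwarzian derivatives $S_n[f]$ are defined as follows. For $z\in D$ with $f(z)\neq\infty$ and $f'(z)\neq0$, let $M_z$ be the Möbius transformation with $M_z(0)=f(z)$, $M_z'(0)=f'(z)$, $M_z''(0)=f''(z)$, and expand, for small $w$, $$ (M_z^{-1}\circ f)(z+w)=\frac{f'(z)(f(z+w)-f(z))}{\frac12f''(z)(f(z+w)-f(z))+f'(z)^2} =\sum_{n=0}^\infty S_n[f](z)\frac{w^{n+1}}{(n+1)!}. $$ In particular $S_0[f]=1$, $S_1[f]=0$ and $S_2[f]=\frac{f'''}{f'}-\frac32\left(\frac{f''}{f'}\right)^2$. These quantities satisfy $S_n[M\circ f]=S_n[f]$ for every Möbius transformation $M$; accordingly, if $f(z)=\infty$ and $f$ is locally univalent (injective near $z$), $S_n[f](z)$ is defined as $S_n[M\circ f](z)$ for any Möbius $M$ with $M(\infty)\ne\infty$. *)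

theory Defs
  imports "HOL-Complex_Analysis.Complex_Analysis"
begin

(* A meromorphic function is represented by f :: complex => complex with
   f nicely_meromorphic_on D, so is_pole f z expresses f(z) = infinity; the number f z = 0
   stored at a pole is a placeholder. The true value on the Riemann sphere is
   sphere_value f z, with None standing for infinity. *)
definition sphere_value :: "(complex \<Rightarrow> complex) \<Rightarrow> complex \<Rightarrow> complex option" where
  "sphere_value f z = (if is_pole f z then None else Some (f z))"

definition locally_univalent_at :: "(complex \<Rightarrow> complex) \<Rightarrow> complex \<Rightarrow> bool" where
  "locally_univalent_at f z \<longleftrightarrow> (\<exists>r>0. inj_on (sphere_value f) (ball z r))"

(* The composition of f with the Moebius transformation w |-> (a w + b) / (c w + d), whose
   value at infinity is a / c. Where the composition takes the value infinity, division by
   zero gives 0, in agreement with the placeholder convention above. *)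
definition moebius_comp ::
  "complex \<Rightarrow> complex \<Rightarrow> complex \<Rightarrow> complex \<Rightarrow> (complex \<Rightarrow> complex) \<Rightarrow> complex \<Rightarrow> complex" where
  "moebius_comp a b c d f z =
     (case sphere_value f z of None \<Rightarrow> a / c | Some v \<Rightarrow> moebius a b c d v)"

(* w |-> (M_z^{-1} o f)(z + w), where M_z is the Moebius transformation agreeing with
   w |-> f (z + w) at 0 to second order; see osculating_moebius_exists and
   tamanoi_generating_eq_moebius_inverse. *)
definition tamanoi_generating :: "(complex \<Rightarrow> complex) \<Rightarrow> complex \<Rightarrow> complex \<Rightarrow> complex" where
  "tamanoi_generating f z w =
     deriv f z * (f (z + w) - f z) /
       (1 / 2 * (deriv ^^ 2) f z * (f (z + w) - f z) + (deriv f z)\<^sup>2)"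

definition osculating_moebius ::
  "complex \<Rightarrow> complex \<Rightarrow> complex \<Rightarrow> complex \<Rightarrow> (complex \<Rightarrow> complex) \<Rightarrow> complex \<Rightarrow> bool" where
  "osculating_moebius a b c d f z \<longleftrightarrow> a * d - b * c \<noteq> 0 \<and> d \<noteq> 0 \<and>
     moebius a b c d 0 = f z \<and>
     deriv (moebius a b c d) 0 = deriv f z \<and>
     (deriv ^^ 2) (moebius a b c d) 0 = (deriv ^^ 2) f z"

lemma moebius_jet_0:
  assumes "d \<noteq> 0"
  shows "moebius a b c d 0 = b / d"
    and "deriv (moebius a b c d) 0 = (a * d - b * c) / d\<^sup>2"
    and "(deriv ^^ 2) (moebius a b c d) 0 = - 2 * c * (a * d - b * c) / d ^ 3"
proof -
  have D: "deriv (moebius a b c d) w = (a * d - b * c) / (c * w + d)\<^sup>2"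
    if "c * w + d \<noteq> 0" for w
    by (rule DERIV_imp_deriv)
       (use that in \<open>auto simp: moebius_def [abs_def] power2_eq_square field_simps
                       intro!: derivative_eq_intros\<close>)
  show "moebius a b c d 0 = b / d" by (simp add: moebius_def)
  show "deriv (moebius a b c d) 0 = (a * d - b * c) / d\<^sup>2" using D[of 0] assms by simp
  have "isCont (\<lambda>w. c * w + d) 0" by (intro continuous_intros)
  then have "\<forall>\<^sub>F w in nhds 0. c * w + d \<noteq> 0"
    using assms by (intro tendsto_imp_eventually_ne) (auto simp: isCont_def tendsto_nhds_iff)
  then have "\<forall>\<^sub>F w in nhds 0. deriv (moebius a b c d) w = (a * d - b * c) / (c * w + d)\<^sup>2"
    by eventually_elim (rule D)
  then have "deriv (deriv (moebius a b c d)) 0 = deriv (\<lambda>w. (a * d - b * c) / (c * w + d)\<^sup>2) 0"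
    by (rule deriv_cong_ev) simp
  also have "\<dots> = - 2 * c * (a * d - b * c) / d ^ 3"
    by (rule DERIV_imp_deriv)
       (use assms in \<open>auto simp: power2_eq_square power3_eq_cube field_simps
                        intro!: derivative_eq_intros\<close>)
  finally show "(deriv ^^ 2) (moebius a b c d) 0 = - 2 * c * (a * d - b * c) / d ^ 3"
    by (simp add: numeral_2_eq_2)
qed

lemma osculating_moebius_exists:
  assumes "deriv f z \<noteq> 0"
  shows "\<exists>a b c d. osculating_moebius a b c d f z"
proof -
  define k where "k = (deriv ^^ 2) f z / (2 * deriv f z)"
  have "osculating_moebius (deriv f z - k * f z) (f z) (- k) 1 f z"
    unfolding osculating_moebius_def
    using assms by (simp add: moebius_jet_0 del: funpow.simps) (simp add: k_def)
  then show ?thesis by blast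
qed

lemma tamanoi_generating_eq_moebius_inverse:
  assumes "osculating_moebius a b c d f z"
  shows "tamanoi_generating f z w = moebius d (- b) (- c) a (f (z + w))"
proof -
  define e where "e = a * d - b * c"
  have e: "e \<noteq> 0" "d \<noteq> 0" and j: "f z = b / d" "deriv f z = e / d\<^sup>2"
      "(deriv ^^ 2) f z = - 2 * c * e / d ^ 3"
    using assms unfolding osculating_moebius_def by (auto simp: moebius_jet_0 e_def)
  define v where "v = f (z + w)"
  have num: "deriv f z * (v - f z) = e / d ^ 3 * (d * v - b)"
    using e by (simp add: j field_simps power2_eq_square power3_eq_cube)
  have "1 / 2 * (deriv ^^ 2) f z * (v - f z) + (deriv f z)\<^sup>2 = e / d ^ 4 * (e - c * (d * v - b))"
    using e by (simp add: j divide_simps power2_eq_square power3_eq_cube power4_eq_xxxx)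
               (simp add: algebra_simps)
  also have "e - c * (d * v - b) = d * (a - c * v)" by (simp add: e_def algebra_simps)
  also have "e / d ^ 4 * (d * (a - c * v)) = e / d ^ 3 * (a - c * v)"
    using e by (simp add: power3_eq_cube power4_eq_xxxx)
  finally have den: "1 / 2 * (deriv ^^ 2) f z * (v - f z) + (deriv f z)\<^sup>2 = e / d ^ 3 * (a - c * v)" .
  show ?thesis
    using e unfolding tamanoi_generating_def v_def[symmetric] num den
    by (simp add: moebius_def)
qed

(* S_n at a point where f is finite (and has nonzero derivative): the coefficient of
   w^(n+1) / (n+1)! in the expansion of the generating function at w = 0. *)
definition tamanoi_schwarzian_finite :: "nat \<Rightarrow> (complex \<Rightarrow> complex) \<Rightarrow> complex \<Rightarrow> complex" where
  "tamanoi_schwarzian_finite n f z =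
     fact (n + 1) * fps_nth (fps_expansion (tamanoi_generating f z) 0) (n + 1)"

(* At a pole, S_n is the common value of S_n[M o f] for all Moebius transformations M with
   M(infinity) finite, i.e. with c nonzero. *)
definition tamanoi_schwarzian :: "nat \<Rightarrow> (complex \<Rightarrow> complex) \<Rightarrow> complex \<Rightarrow> complex" where
  "tamanoi_schwarzian n f z =
     (if is_pole f z
      then THE s. \<forall>a b c d. a * d - b * c \<noteq> 0 \<longrightarrow> c \<noteq> 0 \<longrightarrow>
             tamanoi_schwarzian_finite n (moebius_comp a b c d f) z = s
      else tamanoi_schwarzian_finite n f z)"

end

theory Submission
  imports Defs
begin

text \<open>
  Write \<open>G(z, w)\<close> for the generating function \<open>(M\<^sub>z\<inverse> \<circ> f)(z + w)\<close>, where \<open>M\<^sub>z\<close> is the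
  osculating Moebius transformation. If \<open>M\<^sub>z\<close> did not depend on \<open>z\<close>, then \<open>G\<close> would depend
  on \<open>z + w\<close> only, and its derivatives in \<open>z\<close> and in \<open>w\<close> would agree. In fact \<open>M\<^sub>z\<close> moves,
  and the flow of a family of Moebius transformations is generated by quadratic polynomials, so
  that the two derivatives differ by a quadratic polynomial in \<open>G\<close>. Since \<open>M\<^sub>z\<close> matches \<open>f\<close> to
  second order at \<open>z\<close>, this polynomial is \<open>1 + S\<^sub>2 G\<^sup>2 / 2\<close>: the Riccati equation
  \<open>\<partial>\<^sub>w G = \<partial>\<^sub>z G + 1 + S\<^sub>2 G\<^sup>2 / 2\<close> holds. Comparing the coefficients of \<open>w ^ n / n!\<close> on both sides
  gives the recurrence, because those of \<open>\<partial>\<^sub>w G\<close> and \<open>\<partial>\<^sub>z G\<close> are \<open>S\<^sub>n\<close> and the derivative of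
  \<open>S\<^sub>n\<^sub>-\<^sub>1\<close>, and that of \<open>G\<^sup>2\<close> is the binomial convolution.

  To make sense of \<open>\<partial>\<^sub>z G\<close> without a theory of functions of two complex variables, \<open>G(z, w)\<close> is
  viewed as a formal power series in \<open>w\<close> whose coefficients depend on \<open>z\<close>, and \<open>\<partial>\<^sub>z\<close> acts on
  the coefficients (\<open>has_coeff_derivative\<close>). The equation then follows in \<open>tamanoi_fps_riccati\<close>
  by differentiating the identity \<open>G\<close> times denominator equals numerator in both variables.

  This covers the points where \<open>f\<close> is finite. Near a pole \<open>1 / f\<close> is a finite local coordinate
  of the sphere, and the Moebius invariance \<open>tamanoi_schwarzian_finite_moebius_invariant\<close>
  identifies every \<open>S\<^sub>n[f]\<close> with \<open>S\<^sub>n[1 / f]\<close> on a full neighbourhood of the pole, so that the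
  derivative of \<open>S\<^sub>n\<^sub>-\<^sub>1\<close> there is the one known from the finite case.
\<close>

lemma isCont_eventually_nonzero:
  fixes h :: "complex \<Rightarrow> complex"
  assumes "isCont h z" and "h z \<noteq> 0"
  shows "\<forall>\<^sub>F w in nhds z. h w \<noteq> 0"
  using assms by (intro tendsto_imp_eventually_ne) (auto simp: isCont_def tendsto_nhds_iff)

section \<open>Power series with coefficients depending on a parameter\<close>

definition has_coeff_derivative ::
  "(complex \<Rightarrow> complex fps) \<Rightarrow> complex fps \<Rightarrow> complex \<Rightarrow> bool" where
  "has_coeff_derivative A A' z \<longleftrightarrow>
     (\<forall>n. ((\<lambda>u. fps_nth (A u) n) has_field_derivative fps_nth A' n) (at z))"

lemma has_coeff_derivativeD:
  "has_coeff_derivative A A' z \<Longrightarrow>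
     ((\<lambda>u. fps_nth (A u) n) has_field_derivative fps_nth A' n) (at z)"
  unfolding has_coeff_derivative_def by blast

lemma has_coeff_derivative_const:
  assumes "(h has_field_derivative h') (at z)"
  shows "has_coeff_derivative (\<lambda>u. fps_const (h u)) (fps_const h') z"
  unfolding has_coeff_derivative_def
proof
  fix n
  show "((\<lambda>u. fps_nth (fps_const (h u)) n) has_field_derivative fps_nth (fps_const h') n) (at z)"
    using assms by (cases "n = 0") auto
qed

lemma has_coeff_derivative_add:
  assumes "has_coeff_derivative A A' z" and "has_coeff_derivative B B' z"
  shows "has_coeff_derivative (\<lambda>u. A u + B u) (A' + B') z"
  using assms unfolding has_coeff_derivative_def by (auto intro!: derivative_intros)

lemma has_coeff_derivative_diff:
  assumes "has_coeff_derivative A A' z" and "has_coeff_derivative B B' z"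
  shows "has_coeff_derivative (\<lambda>u. A u - B u) (A' - B') z"
  using assms unfolding has_coeff_derivative_def by (auto intro!: derivative_intros)

lemma has_coeff_derivative_mult:
  assumes A: "has_coeff_derivative A A' z" and B: "has_coeff_derivative B B' z"
  shows "has_coeff_derivative (\<lambda>u. A u * B u) (A' * B z + A z * B') z"
  unfolding has_coeff_derivative_def
proof
  fix n
  have "((\<lambda>u. \<Sum>i=0..n. fps_nth (A u) i * fps_nth (B u) (n - i)) has_field_derivative
          (\<Sum>i=0..n. fps_nth A' i * fps_nth (B z) (n - i) + fps_nth B' (n - i) * fps_nth (A z) i))
        (at z)"
    by (intro DERIV_sum DERIV_mult has_coeff_derivativeD A B)
  then show "((\<lambda>u. fps_nth (A u * B u) n) has_field_derivative
               fps_nth (A' * B z + A z * B') n) (at z)"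
    by (simp add: fps_mult_nth sum.distrib mult.commute[of "fps_nth B' _"])
qed

lemma has_coeff_derivative_unique:
  assumes "has_coeff_derivative A A' z" and "has_coeff_derivative B B' z"
    and "\<forall>\<^sub>F u in nhds z. A u = B u"
  shows "A' = B'"
proof (rule fps_ext)
  fix n
  have "\<forall>\<^sub>F u in nhds z. fps_nth (A u) n = fps_nth (B u) n"
    using assms(3) by eventually_elim simp
  with has_coeff_derivativeD[OF assms(1), of n]
  have "((\<lambda>u. fps_nth (B u) n) has_field_derivative fps_nth A' n) (at z)"
    by (subst (asm) DERIV_cong_ev[OF refl _ refl]) auto
  then show "fps_nth A' n = fps_nth B' n"
    using has_coeff_derivativeD[OF assms(2)] by (rule DERIV_unique)
qed

text \<open>
  The coefficients of a quotient are determined recursively, with division by the constant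
  coefficient of the denominator only; their differentiability follows by induction, and the
  value of the derivative is then forced by the product rule.
\<close>
lemma has_coeff_derivative_quotient:
  assumes B: "has_coeff_derivative B B' z" and C: "has_coeff_derivative C C' z"
    and eq: "\<forall>\<^sub>F u in nhds z. A u * B u = C u" and nz: "fps_nth (B z) 0 \<noteq> 0"
  obtains A' where "has_coeff_derivative A A' z" and "A' * B z + A z * B' = C'"
proof -
  have "isCont (\<lambda>u. fps_nth (B u) 0) z"
    using has_coeff_derivativeD[OF B] by (rule DERIV_isCont)
  then have nz_near: "\<forall>\<^sub>F u in nhds z. fps_nth (B u) 0 \<noteq> 0"
    using nz by (rule isCont_eventually_nonzero)
  have "(\<lambda>u. fps_nth (A u) n) field_differentiable (at z)" for n
  proof (induction n rule: less_induct)
    case (less n)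
    \<comment> \<open>the \<open>n\<close>-th coefficient of \<open>A u * B u = C u\<close>, solved for the top coefficient of \<open>A u\<close>\<close>
    have ev: "\<forall>\<^sub>F u in nhds z. fps_nth (A u) n =
        (fps_nth (C u) n - (\<Sum>i<n. fps_nth (A u) i * fps_nth (B u) (n - i))) / fps_nth (B u) 0"
      using eq nz_near
    proof eventually_elim
      case (elim u)
      have "fps_nth (C u) n = (\<Sum>i\<le>n. fps_nth (A u) i * fps_nth (B u) (n - i))"
        unfolding elim(1)[symmetric] by (simp add: fps_mult_nth atLeast0AtMost)
      also have "{..n} = insert n {..<n}" by auto
      finally show ?case using elim(2) by (simp add: field_simps)
    qed
    have "(\<lambda>u. (fps_nth (C u) n - (\<Sum>i<n. fps_nth (A u) i * fps_nth (B u) (n - i))) / fps_nth (B u) 0)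
            field_differentiable (at z)"
      using less has_coeff_derivativeD[OF B] has_coeff_derivativeD[OF C] nz
      by (intro field_differentiable_divide field_differentiable_diff field_differentiable_sum
            field_differentiable_mult) (auto simp: field_differentiable_def)
    then show ?case
      unfolding field_differentiable_def using DERIV_cong_ev[OF refl ev refl] by blast
  qed
  then have A: "has_coeff_derivative A (Abs_fps (\<lambda>n. deriv (\<lambda>u. fps_nth (A u) n) z)) z"
    unfolding has_coeff_derivative_def by (simp add: field_differentiable_derivI)
  moreover have "Abs_fps (\<lambda>n. deriv (\<lambda>u. fps_nth (A u) n) z) * B z + A z * B' = C'"
    using has_coeff_derivative_mult[OF A B] C eq by (rule has_coeff_derivative_unique)
  ultimately show ?thesis using that by blast
qed

text \<open>
  The series of \<open>f\<close> at \<open>z\<close> represents \<open>f (z + w)\<close>, whose derivatives in \<open>z\<close> and in \<open>w\<close> agree.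
\<close>
lemma has_coeff_derivative_fps_expansion:
  assumes "f analytic_on {z}"
  shows "has_coeff_derivative (fps_expansion f) (fps_deriv (fps_expansion f z)) z"
  unfolding has_coeff_derivative_def
proof
  fix n
  have "((deriv ^^ n) f has_field_derivative (deriv ^^ Suc n) f z) (at z)"
    using assms analytic_at has_field_derivative_higher_deriv by blast
  then have "((\<lambda>u. (deriv ^^ n) f u / fact n) has_field_derivative (deriv ^^ Suc n) f z / fact n) (at z)"
    by (rule DERIV_cdivide)
  moreover have "(deriv ^^ Suc n) f z / fact n = fps_nth (fps_deriv (fps_expansion f z)) n"
    by (simp add: fps_expansion_def del: funpow.simps of_nat_Suc)
  ultimately show "((\<lambda>u. fps_nth (fps_expansion f u) n) has_field_derivative
      fps_nth (fps_deriv (fps_expansion f z)) n) (at z)"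
    by (simp add: fps_expansion_def)
qed

section \<open>The Riccati equation of the generating function\<close>

abbreviation tamanoi_fps :: "(complex \<Rightarrow> complex) \<Rightarrow> complex \<Rightarrow> complex fps" where
  "tamanoi_fps f z \<equiv> fps_expansion (tamanoi_generating f z) 0"

lemma tamanoi_fps_mult_denominator:
  assumes f: "f analytic_on {z}" and nz: "deriv f z \<noteq> 0"
  defines "F \<equiv> fps_expansion f z - fps_const (f z)"
  shows "tamanoi_fps f z * (fps_const (1 / 2 * (deriv ^^ 2) f z) * F + fps_const ((deriv f z)\<^sup>2)) =
         fps_const (deriv f z) * F"
proof -
  define Den where "Den = fps_const (1 / 2 * (deriv ^^ 2) f z) * F + fps_const ((deriv f z)\<^sup>2)"
  have F: "(\<lambda>w. f (z + w) - f z) has_fps_expansion F"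
    unfolding F_def by (intro fps_expansion_intros analytic_at_imp_has_fps_expansion f)
  have Den0: "fps_nth Den 0 \<noteq> 0"
    using nz by (simp add: Den_def F_def fps_expansion_def)
  have "(\<lambda>w. tamanoi_generating f z w) has_fps_expansion (fps_const (deriv f z) * F / Den)"
    unfolding tamanoi_generating_def
    using F Den0 unfolding Den_def by (intro fps_expansion_intros)
  then have "tamanoi_fps f z = fps_const (deriv f z) * F / Den"
    by (rule fps_expansion_eqI)
  moreover have "fps_const (deriv f z) * F / Den * Den = fps_const (deriv f z) * F"
    using Den0 by (intro dvd_div_mult_self) (simp add: fps_dvd_iff subdegree_eq_0)
  ultimately show ?thesis unfolding Den_def by simp
qed

lemma eventually_analytic_at:
  assumes "f analytic_on {z}"
  shows "\<forall>\<^sub>F u in nhds z. f analytic_on {u}"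
proof -
  obtain S where S: "open S" "z \<in> S" "f holomorphic_on S"
    using assms analytic_at by blast
  then have "\<forall>\<^sub>F u in nhds z. u \<in> S" by (intro eventually_nhds_in_open)
  then show ?thesis
    by eventually_elim (rule holomorphic_on_imp_analytic_at[OF S(3,1)])
qed

lemma eventually_deriv_nonzero:
  fixes f :: "complex \<Rightarrow> complex"
  assumes "f analytic_on {z}" and "deriv f z \<noteq> 0"
  shows "\<forall>\<^sub>F u in nhds z. f analytic_on {u} \<and> deriv f u \<noteq> 0"
proof -
  have "isCont (deriv f) z"
    using assms by (intro analytic_at_imp_isCont analytic_intros)
  then have "\<forall>\<^sub>F u in nhds z. deriv f u \<noteq> 0"
    using assms(2) by (rule isCont_eventually_nonzero)
  with eventually_analytic_at[OF assms(1)] show ?thesis by (rule eventually_conj)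
qed

text \<open>
  Comparing the coefficients of \<open>w, w\<^sup>2, w\<^sup>3\<close> in the product identity gives \<open>S\<^sub>0 = 1\<close>, \<open>S\<^sub>1 = 0\<close>
  and the classical Schwarzian for \<open>S\<^sub>2\<close>, stated here after multiplication by \<open>f'\<^sup>2\<close>.
\<close>
lemma tamanoi_fps_low_coeffs:
  assumes f: "f analytic_on {z}" and nz: "deriv f z \<noteq> 0"
  shows "fps_nth (tamanoi_fps f z) 0 = 0"
    and "(deriv f z)\<^sup>2 * tamanoi_schwarzian_finite 2 f z =
         deriv f z * (deriv ^^ 3) f z - 3 / 2 * ((deriv ^^ 2) f z)\<^sup>2"
proof -
  define g where "g = fps_nth (tamanoi_fps f z)"
  define F where "F = fps_expansion f z - fps_const (f z)"
  define a where "a = deriv f z"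
  define b where "b = (deriv ^^ 2) f z"
  define c where "c = (deriv ^^ 3) f z"
  have a: "a \<noteq> 0" using nz by (simp add: a_def)
  have F_coeffs: "fps_nth F 0 = 0" "fps_nth F 1 = a" "fps_nth F 2 = b / 2" "fps_nth F 3 = c / 6"
    by (simp_all add: F_def fps_expansion_def a_def b_def c_def fact_numeral)
  note F_Suc = F_coeffs[unfolded One_nat_def numeral_2_eq_2 numeral_3_eq_3]
  have eq: "tamanoi_fps f z * (fps_const (1 / 2 * b) * F + fps_const (a\<^sup>2)) = fps_const a * F"
    unfolding a_def b_def F_def by (rule tamanoi_fps_mult_denominator[OF f nz])
  have coeff: "fps_nth (fps_const (1 / 2 * b) * (tamanoi_fps f z * F)) n + a\<^sup>2 * g n = a * fps_nth F n" for n
    using arg_cong[OF eq, of "\<lambda>A. fps_nth A n"] unfolding g_def by (simp add: algebra_simps)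
  have prod: "fps_nth (fps_const (1 / 2 * b) * (tamanoi_fps f z * F)) n =
      b / 2 * (\<Sum>i=0..n. g i * fps_nth F (n - i))" for n
    unfolding fps_mult_left_const_nth by (simp add: fps_mult_nth g_def)
  show g0: "fps_nth (tamanoi_fps f z) 0 = 0"
    using coeff[of 0] a unfolding prod by (simp add: F_coeffs g_def)
  have g1: "g 1 = 1"
    using coeff[of 1] a g0 unfolding prod by (simp add: F_Suc g_def power2_eq_square)
  have g2: "g 2 = 0"
    using coeff[of 2] a g0 g1 unfolding prod
    by (simp add: F_Suc g_def power2_eq_square numeral_2_eq_2)
  have g3: "b / 2 * (b / 2) + a\<^sup>2 * g 3 = a * (c / 6)"
    using coeff[of 3] a g0 g1 g2 unfolding prod
    by (simp add: F_Suc g_def numeral_3_eq_3 numeral_2_eq_2)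
  have "6 * (a\<^sup>2 * g 3) = 6 * (b / 2 * (b / 2) + a\<^sup>2 * g 3) - 3 / 2 * b\<^sup>2"
    by (simp add: algebra_simps power2_eq_square)
  also have "\<dots> = a * c - 3 / 2 * b\<^sup>2" unfolding g3 by simp
  finally have "6 * (a\<^sup>2 * g 3) = a * c - 3 / 2 * b\<^sup>2" .
  moreover have "tamanoi_schwarzian_finite 2 f z = 6 * g 3"
    by (simp add: tamanoi_schwarzian_finite_def g_def fact_numeral)
  ultimately show "(deriv f z)\<^sup>2 * tamanoi_schwarzian_finite 2 f z =
         deriv f z * (deriv ^^ 3) f z - 3 / 2 * ((deriv ^^ 2) f z)\<^sup>2"
    unfolding a_def b_def c_def by (simp add: mult_ac)
qed

text \<open>
  Let \<open>F = f (z + w) - f z\<close>, so that \<open>\<partial>\<^sub>z F = \<partial>\<^sub>w F - f'\<close>, and let \<open>Den = f'' F / 2 + f'\<^sup>2\<close> be the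
  denominator of \<open>G = f' F / Den\<close>. Differentiating \<open>G Den = f' F\<close> in \<open>w\<close> gives
  \<open>Den\<^sup>2 \<partial>\<^sub>w G = f'\<^sup>3 \<partial>\<^sub>w F\<close>. Differentiating it in \<open>z\<close> gives the same term with the remainder
  \<open>- Den\<^sup>2 - S\<^sub>2 f'\<^sup>2 F\<^sup>2 / 2 = - Den\<^sup>2 (1 + S\<^sub>2 G\<^sup>2 / 2)\<close>.
\<close>
lemma tamanoi_fps_riccati:
  assumes f: "f analytic_on {z}" and nz: "deriv f z \<noteq> 0"
  obtains G' where "has_coeff_derivative (tamanoi_fps f) G' z"
    and "fps_deriv (tamanoi_fps f z) =
           G' + 1 + fps_const (1 / 2 * tamanoi_schwarzian_finite 2 f z) * (tamanoi_fps f z)\<^sup>2"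
proof -
  define F where "F = (\<lambda>u. fps_expansion f u - fps_const (f u))"
  define G where "G = tamanoi_fps f z"
  \<comment> \<open>The halves are absorbed into \<open>\<beta>\<close>, \<open>\<gamma>\<close>, \<open>\<sigma>\<close> so that the identities below have integer
    coefficients and the final step is pure commutative ring reasoning.\<close>
  define A where "A = fps_const (deriv f z)"
  define \<beta> where "\<beta> = fps_const (1 / 2 * (deriv ^^ 2) f z)"
  define \<gamma> where "\<gamma> = fps_const (1 / 2 * (deriv ^^ 3) f z)"
  define \<sigma> where "\<sigma> = fps_const (1 / 2 * tamanoi_schwarzian_finite 2 f z)"
  define Den where "Den = (\<lambda>u. fps_const (1 / 2 * (deriv ^^ 2) f u) * F u + fps_const ((deriv f u)\<^sup>2))"
  define FX where "FX = fps_deriv (fps_expansion f z)"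
  have higher: "((deriv ^^ n) f has_field_derivative (deriv ^^ Suc n) f z) (at z)" for n
    using f analytic_at has_field_derivative_higher_deriv by blast
  have d0: "(f has_field_derivative deriv f z) (at z)" using higher[of 0] by simp
  have d1: "(deriv f has_field_derivative (deriv ^^ 2) f z) (at z)"
    using higher[of 1] by (simp add: numeral_2_eq_2)
  have d2: "((deriv ^^ 2) f has_field_derivative (deriv ^^ 3) f z) (at z)"
    using higher[of 2] by (simp add: numeral_2_eq_2 numeral_3_eq_3)
  have F': "has_coeff_derivative F (FX - A) z"
    unfolding F_def FX_def A_def
    by (intro has_coeff_derivative_diff has_coeff_derivative_fps_expansion
          has_coeff_derivative_const f d0)
  have "((\<lambda>u. (deriv f u)\<^sup>2) has_field_derivative 2 * deriv f z * (deriv ^^ 2) f z) (at z)"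
    using d1 by (auto intro!: derivative_eq_intros simp del: funpow.simps)
  then have "has_coeff_derivative (\<lambda>u. fps_const ((deriv f u)\<^sup>2))
      (fps_const (2 * deriv f z * (deriv ^^ 2) f z)) z"
    by (rule has_coeff_derivative_const)
  also have "fps_const (2 * deriv f z * (deriv ^^ 2) f z) = 4 * A * \<beta>"
    unfolding A_def \<beta>_def by (simp add: numeral_fps_const fps_const_mult del: funpow.simps)
  finally have sq': "has_coeff_derivative (\<lambda>u. fps_const ((deriv f u)\<^sup>2)) (4 * A * \<beta>) z" .
  have "has_coeff_derivative (\<lambda>u. fps_const (1 / 2 * (deriv ^^ 2) f u)) \<gamma> z"
    unfolding \<gamma>_def by (intro has_coeff_derivative_const DERIV_cmult d2)
  then have Den': "has_coeff_derivative Den (\<gamma> * F z + \<beta> * (FX - A) + 4 * A * \<beta>) z"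
    unfolding Den_def \<beta>_def
    by (intro has_coeff_derivative_add has_coeff_derivative_mult F' sq'[unfolded \<beta>_def])
  have "fps_const ((deriv ^^ 2) f z) = 2 * \<beta>"
    unfolding \<beta>_def by (simp add: numeral_fps_const fps_const_mult del: funpow.simps)
  then have Num': "has_coeff_derivative (\<lambda>u. fps_const (deriv f u) * F u) (2 * \<beta> * F z + A * (FX - A)) z"
    using has_coeff_derivative_mult[OF has_coeff_derivative_const[OF d1] F'] by (simp add: A_def)
  have quot: "\<forall>\<^sub>F u in nhds z. tamanoi_fps f u * Den u = fps_const (deriv f u) * F u"
    using eventually_deriv_nonzero[OF f nz]
    unfolding Den_def F_def by eventually_elim (intro tamanoi_fps_mult_denominator; simp)
  have Den0: "fps_nth (Den z) 0 \<noteq> 0"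
    using nz by (simp add: Den_def F_def fps_expansion_def)
  obtain G' where G': "has_coeff_derivative (tamanoi_fps f) G' z"
    and Gz: "G' * Den z + G * (\<gamma> * F z + \<beta> * (FX - A) + 4 * A * \<beta>) = 2 * \<beta> * F z + A * (FX - A)"
    using has_coeff_derivative_quotient[OF Den' Num' quot Den0] unfolding G_def by blast
  have G: "G * Den z = A * F z"
    using eventually_nhds_x_imp_x[OF quot] by (simp add: G_def A_def)
  have Den: "Den z = \<beta> * F z + A\<^sup>2"
    by (simp add: Den_def \<beta>_def A_def fps_const_power)
  have FXd: "fps_deriv (F z) = FX" by (simp add: F_def FX_def)
  have GX: "fps_deriv G * Den z + G * (\<beta> * FX) = A * FX"
    using arg_cong[OF G, of fps_deriv] FXd unfolding Den
    by (simp add: \<beta>_def A_def fps_const_power algebra_simps)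
  have "A\<^sup>2 * \<sigma> = A * \<gamma> - 3 * \<beta>\<^sup>2"
    using tamanoi_fps_low_coeffs(2)[OF f nz]
    unfolding A_def \<sigma>_def \<gamma>_def \<beta>_def
    by (simp add: numeral_fps_const fps_const_power fps_const_mult fps_const_sub power2_eq_square
          field_simps del: funpow.simps)
  then have "Den z * Den z * fps_deriv G = Den z * Den z * (G' + 1 + \<sigma> * G\<^sup>2)"
    using Gz G GX unfolding Den by algebra
  moreover have "Den z \<noteq> 0" using Den0 by auto
  ultimately have "fps_deriv G = G' + 1 + \<sigma> * G\<^sup>2" by simp
  with G' show ?thesis using that unfolding G_def \<sigma>_def by blast
qed

text \<open>
  The constant \<open>1\<close> in the Riccati equation contributes to the coefficient of \<open>w\<^sup>0\<close> only, which is
  why the recurrence starts at \<open>n = 1\<close>.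
\<close>
lemma tamanoi_schwarzian_finite_recurrence:
  assumes f: "f analytic_on {z}" and nz: "deriv f z \<noteq> 0" and n: "n \<ge> 1"
  shows "tamanoi_schwarzian_finite (n - 1) f field_differentiable (at z)"
    and "tamanoi_schwarzian_finite n f z =
      deriv (tamanoi_schwarzian_finite (n - 1) f) z +
      1 / 2 * tamanoi_schwarzian_finite 2 f z *
        (\<Sum>k = 1..n - 1. of_nat (n choose k) *
           tamanoi_schwarzian_finite (k - 1) f z * tamanoi_schwarzian_finite (n - k - 1) f z)"
proof -
  define g where "g = fps_nth (tamanoi_fps f z)"
  define s where "s = tamanoi_schwarzian_finite 2 f z"
  obtain G' where G': "has_coeff_derivative (tamanoi_fps f) G' z"
    and riccati: "fps_deriv (tamanoi_fps f z) = G' + 1 + fps_const (1 / 2 * s) * (tamanoi_fps f z)\<^sup>2"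
    using tamanoi_fps_riccati[OF f nz] unfolding s_def by blast
  have S: "tamanoi_schwarzian_finite (m - 1) f u = fact m * fps_nth (tamanoi_fps f u) m"
    if "m \<ge> 1" for m u
    using that by (simp add: tamanoi_schwarzian_finite_def)
  have "tamanoi_schwarzian_finite (n - 1) f = (\<lambda>u. fact n * fps_nth (tamanoi_fps f u) n)"
    using S[OF n] by (rule ext)
  then have der: "(tamanoi_schwarzian_finite (n - 1) f has_field_derivative fact n * fps_nth G' n) (at z)"
    by (simp only:) (intro DERIV_cmult has_coeff_derivativeD[OF G'])
  then show "tamanoi_schwarzian_finite (n - 1) f field_differentiable (at z)"
    by (auto simp: field_differentiable_def)
  \<comment> \<open>As \<open>G\<close> vanishes at \<open>w = 0\<close>, the two extreme terms of the convolution drop out.\<close>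
  have g0: "g 0 = 0" using tamanoi_fps_low_coeffs(1)[OF f nz] by (simp add: g_def)
  have "fact n * fps_nth ((tamanoi_fps f z)\<^sup>2) n = (\<Sum>k=0..n. fact n * (g k * g (n - k)))"
    by (simp add: power2_eq_square fps_mult_nth g_def sum_distrib_left)
  also have "\<dots> = (\<Sum>k=1..n - 1. fact n * (g k * g (n - k)))"
  proof (rule sum.mono_neutral_right)
    have "k = 0 \<or> k = n" if "k \<in> {0..n} - {1..n - 1}" for k using that by auto
    then show "\<forall>k\<in>{0..n} - {1..n - 1}. fact n * (g k * g (n - k)) = 0" using g0 by fastforce
  qed auto
  also have "\<dots> = (\<Sum>k=1..n - 1. of_nat (n choose k) *
      tamanoi_schwarzian_finite (k - 1) f z * tamanoi_schwarzian_finite (n - k - 1) f z)"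
  proof (rule sum.cong)
    fix k assume k: "k \<in> {1..n - 1}"
    then have "k \<le> n" by auto
    then have "fact n = of_nat (n choose k) * (fact k * fact (n - k) :: complex)"
      by (simp add: binomial_fact)
    moreover have "k \<ge> 1" "n - k \<ge> 1" using k n by auto
    ultimately show "fact n * (g k * g (n - k)) = of_nat (n choose k) *
        tamanoi_schwarzian_finite (k - 1) f z * tamanoi_schwarzian_finite (n - k - 1) f z"
      using S[of k z] S[of "n - k" z] by (simp add: g_def)
  qed simp
  finally have square: "fact n * fps_nth ((tamanoi_fps f z)\<^sup>2) n = \<dots>" .
  have "tamanoi_schwarzian_finite n f z = fact n * fps_nth (fps_deriv (tamanoi_fps f z)) n"
    by (simp add: tamanoi_schwarzian_finite_def)
  also have "\<dots> = fact n * fps_nth G' n + 1 / 2 * s * (fact n * fps_nth ((tamanoi_fps f z)\<^sup>2) n)"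
    using n unfolding riccati by (simp add: algebra_simps)
  finally show "tamanoi_schwarzian_finite n f z =
      deriv (tamanoi_schwarzian_finite (n - 1) f) z +
      1 / 2 * tamanoi_schwarzian_finite 2 f z *
        (\<Sum>k = 1..n - 1. of_nat (n choose k) *
           tamanoi_schwarzian_finite (k - 1) f z * tamanoi_schwarzian_finite (n - k - 1) f z)"
    unfolding square DERIV_imp_deriv[OF der] s_def .
qed

section \<open>Moebius invariance\<close>

lemma moebius_compose_jet:
  assumes g: "g analytic_on {z}" and q: "c * g z + d \<noteq> 0"
    and k: "\<forall>\<^sub>F w in nhds z. k w = moebius a b c d (g w)"
  shows "deriv k z = (a * d - b * c) * deriv g z / (c * g z + d)\<^sup>2"
    and "(deriv ^^ 2) k z = (a * d - b * c) *
           ((deriv ^^ 2) g z / (c * g z + d)\<^sup>2 - 2 * c * (deriv g z)\<^sup>2 / (c * g z + d) ^ 3)"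
proof -
  have D: "deriv k w = (a * d - b * c) * deriv g w / (c * g w + d)\<^sup>2"
    if "g analytic_on {w}" "c * g w + d \<noteq> 0" "\<forall>\<^sub>F u in nhds w. k u = moebius a b c d (g u)" for w
  proof -
    have "(g has_field_derivative deriv g w) (at w)" using that(1) by (rule analytic_derivI)
    then have "((\<lambda>u. moebius a b c d (g u)) has_field_derivative
        (a * d - b * c) * deriv g w / (c * g w + d)\<^sup>2) (at w)"
      using that(2) unfolding moebius_def
      by (auto intro!: derivative_eq_intros simp: power2_eq_square) (simp add: field_simps)
    then show ?thesis using deriv_cong_ev[OF that(3) refl] DERIV_imp_deriv by metis
  qed
  show "deriv k z = (a * d - b * c) * deriv g z / (c * g z + d)\<^sup>2" by (rule D[OF g q k])
  have "\<forall>\<^sub>F w in nhds z. c * g w + d \<noteq> 0"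
    using g q by (intro isCont_eventually_nonzero continuous_intros analytic_at_imp_isCont)
  moreover have "\<forall>\<^sub>F w in nhds z. g analytic_on {w}"
    using g by (rule eventually_analytic_at)
  moreover have "\<forall>\<^sub>F w in nhds z. \<forall>\<^sub>F u in nhds w. k u = moebius a b c d (g u)"
    using k by (simp add: eventually_eventually)
  ultimately have "\<forall>\<^sub>F w in nhds z. deriv k w = (a * d - b * c) * deriv g w / (c * g w + d)\<^sup>2"
    by eventually_elim (rule D)
  then have "deriv (deriv k) z = deriv (\<lambda>w. (a * d - b * c) * deriv g w / (c * g w + d)\<^sup>2) z"
    by (rule deriv_cong_ev) simp
  also have "\<dots> = (a * d - b * c) *
      (deriv (deriv g) z / (c * g z + d)\<^sup>2 - 2 * c * (deriv g z)\<^sup>2 / (c * g z + d) ^ 3)"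
  proof (rule DERIV_imp_deriv)
    define q where "q = c * g z + d"
    define e where "e = a * d - b * c"
    have q0: "q \<noteq> 0" using q by (simp add: q_def)
    have d: "(g has_field_derivative deriv g z) (at z)"
      "(deriv g has_field_derivative deriv (deriv g) z) (at z)"
      using g by (auto intro!: analytic_derivI analytic_intros)
    have "((\<lambda>w. (c * g w + d)\<^sup>2) has_field_derivative 2 * q * (c * deriv g z)) (at z)"
      by (auto intro!: derivative_eq_intros d simp: q_def)
    then have "((\<lambda>w. e * deriv g w / (c * g w + d)\<^sup>2) has_field_derivative
        (e * deriv (deriv g) z * q\<^sup>2 - e * deriv g z * (2 * q * (c * deriv g z))) / (q\<^sup>2 * q\<^sup>2)) (at z)"
      using DERIV_divide[OF DERIV_cmult[OF d(2)]] q0 unfolding q_def by fastforce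
    moreover have "(e * deriv (deriv g) z * q\<^sup>2 - e * deriv g z * (2 * q * (c * deriv g z))) / (q\<^sup>2 * q\<^sup>2) =
        e * (deriv (deriv g) z / q\<^sup>2 - 2 * c * (deriv g z)\<^sup>2 / q ^ 3)"
      using q0 by (simp add: field_simps power2_eq_square power3_eq_cube)
    ultimately show "((\<lambda>w. (a * d - b * c) * deriv g w / (c * g w + d)\<^sup>2) has_field_derivative (a * d - b * c) *
      (deriv (deriv g) z / (c * g z + d)\<^sup>2 - 2 * c * (deriv g z)\<^sup>2 / (c * g z + d) ^ 3)) (at z)"
      unfolding e_def q_def by simp
  qed
  finally show "(deriv ^^ 2) k z = (a * d - b * c) *
      ((deriv ^^ 2) g z / (c * g z + d)\<^sup>2 - 2 * c * (deriv g z)\<^sup>2 / (c * g z + d) ^ 3)"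
    by (simp add: numeral_2_eq_2)
qed

text \<open>
  Composition of \<open>g\<close> with \<open>M\<close> replaces the osculating transformation \<open>M\<^sub>z\<close> by \<open>M \<circ> M\<^sub>z\<close>, and
  \<open>M\<close> cancels in \<open>(M \<circ> M\<^sub>z)\<inverse> \<circ> (M \<circ> g)\<close>. In formulas, the numerator and the denominator of
  the generating function are multiplied by a common nonzero factor.
\<close>
lemma tamanoi_schwarzian_finite_moebius_invariant:
  assumes g: "g analytic_on {z}" and det: "a * d - b * c \<noteq> 0" and q: "c * g z + d \<noteq> 0"
    and k: "\<forall>\<^sub>F w in nhds z. k w = moebius a b c d (g w)"
  shows "tamanoi_schwarzian_finite n k z = tamanoi_schwarzian_finite n g z"
proof -
  have shift: "\<forall>\<^sub>F w in nhds 0. P (z + w)" if "\<forall>\<^sub>F w in nhds z. P w" for P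
    using that unfolding nhds_to_0[of z] by (simp add: eventually_filtermap)
  have p: "\<forall>\<^sub>F w in nhds z. c * g w + d \<noteq> 0"
    using g q by (intro isCont_eventually_nonzero continuous_intros analytic_at_imp_isCont)
  have "\<forall>\<^sub>F w in nhds 0. tamanoi_generating k z w = tamanoi_generating g z w"
    using shift[OF p] shift[OF k]
  proof eventually_elim
    case (elim w)
    define e where "e = a * d - b * c"
    define u where "u = g z"
    define v where "v = g (z + w)"
    define Q where "Q = c * u + d"
    define P where "P = c * v + d"
    define g1 where "g1 = deriv g z"
    define g2 where "g2 = (deriv ^^ 2) g z"
    have nz: "e \<noteq> 0" "P \<noteq> 0" "Q \<noteq> 0"
      using det q elim by (auto simp: e_def P_def Q_def u_def v_def)
    have kz: "k z = (a * u + b) / Q"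
      using eventually_nhds_x_imp_x[OF k] by (simp add: moebius_def u_def Q_def)
    have kw: "k (z + w) = (a * v + b) / P"
      using elim by (simp add: moebius_def v_def P_def)
    have diff: "k (z + w) - k z = e * (v - u) / (P * Q)"
      using nz unfolding kz kw
      by (simp add: divide_simps) (simp add: P_def Q_def e_def algebra_simps)
    have k1: "deriv k z = e * g1 / Q\<^sup>2"
      and k2: "(deriv ^^ 2) k z = e * (g2 / Q\<^sup>2 - 2 * c * g1\<^sup>2 / Q ^ 3)"
      using moebius_compose_jet[OF g q k] by (simp_all add: e_def g1_def g2_def Q_def u_def del: funpow.simps)
    \<comment> \<open>the common factor of numerator and denominator\<close>
    define r where "r = e\<^sup>2 / (P * Q ^ 3)"
    have r: "r \<noteq> 0" using nz by (simp add: r_def)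
    have num: "deriv k z * (k (z + w) - k z) = r * (g1 * (v - u))"
      using nz unfolding diff k1 r_def by (simp add: divide_simps power2_eq_square power3_eq_cube)
    have PQ: "P = Q + c * (v - u)" by (simp add: P_def Q_def algebra_simps)
    have "1 / 2 * (deriv ^^ 2) k z * (k (z + w) - k z) + (deriv k z)\<^sup>2 =
        e\<^sup>2 / (P * Q ^ 4) * (1 / 2 * g2 * (v - u) * Q + g1\<^sup>2 * (P - c * (v - u)))"
      using nz unfolding diff k1 k2
      by (simp add: divide_simps power2_eq_square power3_eq_cube power4_eq_xxxx)
         (simp add: algebra_simps)
    also have "\<dots> = r * (1 / 2 * g2 * (v - u) + g1\<^sup>2)"
      using nz unfolding r_def PQ
      by (simp add: divide_simps power2_eq_square power3_eq_cube power4_eq_xxxx)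
         (simp add: algebra_simps)
    finally show ?case
      using r unfolding tamanoi_generating_def num
      by (simp add: u_def v_def g1_def g2_def del: funpow.simps)
  qed
  then have "tamanoi_fps k z = tamanoi_fps g z" by (rule fps_expansion_cong)
  then show ?thesis by (simp add: tamanoi_schwarzian_finite_def)
qed

section \<open>Local coordinates at points of local univalence\<close>

text \<open>
  The reciprocal extends holomorphically over the pole with value \<open>0\<close>. It inherits injectivity
  from the sphere-valued map, and an injective holomorphic function has nonzero derivative.
\<close>
lemma reciprocal_chart_at_pole:
  assumes mero: "f meromorphic_on {z}" and pole: "is_pole f z" and univ: "locally_univalent_at f z"
  defines "h \<equiv> (\<lambda>w. if w = z then 0 else inverse (f w))"
  obtains r where "r > 0" and "h holomorphic_on ball z r" and "deriv h z \<noteq> 0"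
    and "\<And>w. w \<in> ball z r - {z} \<Longrightarrow> f analytic_on {w} \<and> f w \<noteq> 0"
proof -
  obtain r0 where r0: "r0 > 0" "inj_on (sphere_value f) (ball z r0)"
    using univ by (auto simp: locally_univalent_at_def)
  obtain r1 where r1: "r1 > 0" "f analytic_on ball z r1 - {z}"
    using mero by (auto simp: meromorphic_on_altdef isolated_singularity_at_def dest: meromorphic_onE)
  have "\<forall>\<^sub>F w in at z. f w \<noteq> 0"
    using pole non_zero_neighbour_pole by blast
  then obtain r2 where r2: "r2 > 0" "\<And>w. w \<in> ball z r2 - {z} \<Longrightarrow> f w \<noteq> 0"
    by (auto simp: eventually_at dist_commute)
  define r where "r = min r0 (min r1 r2)"
  have r: "r > 0" using r0 r1 r2 by (simp add: r_def)
  have an: "f analytic_on {w} \<and> f w \<noteq> 0" if "w \<in> ball z r - {z}" for w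
    using that r1(2) r2(2)[of w] by (auto simp: r_def intro: analytic_on_subset)
  have hol: "h holomorphic_on ball z r"
    unfolding h_def
  proof (rule is_pole_inverse_holomorphic)
    show "f holomorphic_on ball z r - {z}"
      using an analytic_on_analytic_at analytic_imp_holomorphic by blast
  qed (use pole an in auto)
  have "inj_on h (ball z r)"
  proof (rule inj_onI)
    fix x y assume x: "x \<in> ball z r" and y: "y \<in> ball z r" and xy: "h x = h y"
    have sv: "sphere_value f w = (if w = z then None else Some (f w))" if "w \<in> ball z r" for w
      using that an[of w] pole analytic_at_imp_no_pole by (auto simp: sphere_value_def)
    have "sphere_value f x = sphere_value f y"
      using xy sv[OF x] sv[OF y] an[of x] an[of y] x y by (auto simp: h_def split: if_splits)
    moreover have "x \<in> ball z r0" "y \<in> ball z r0" using x y by (auto simp: r_def)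
    ultimately show "x = y" using r0(2) by (auto dest: inj_onD)
  qed
  then have "deriv h z \<noteq> 0"
    using hol r by (intro holomorphic_injective_imp_regular) auto
  with r hol an that show ?thesis by blast
qed

text \<open>
  The function \<open>g\<close> is \<open>f\<close> itself at a finite point and the reciprocal of \<open>f\<close> at a pole. The
  equality must hold on a neighbourhood, and not just at \<open>z\<close>, because the recurrence
  differentiates the Schwarzian at \<open>z\<close>.
\<close>
lemma tamanoi_schwarzian_finite_chart:
  assumes mero: "f nicely_meromorphic_on D" and D: "z \<in> D" and univ: "locally_univalent_at f z"
  obtains g where "g analytic_on {z}" and "deriv g z \<noteq> 0"
    and "\<And>n. \<forall>\<^sub>F w in nhds z. tamanoi_schwarzian n f w = tamanoi_schwarzian_finite n g w"
proof (cases "is_pole f z")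
  case False
  have an: "f analytic_on {z}"
    using nicely_meromorphic_on_imp_analytic_at[OF mero D False] .
  then obtain r1 where r1: "r1 > 0" "f holomorphic_on ball z r1"
    unfolding analytic_on_def by auto
  obtain r0 where r0: "r0 > 0" "inj_on (sphere_value f) (ball z r0)"
    using univ by (auto simp: locally_univalent_at_def)
  define r where "r = min r0 r1"
  have r: "r > 0" using r0 r1 by (simp add: r_def)
  have hol: "f holomorphic_on ball z r"
    using r1(2) by (rule holomorphic_on_subset) (auto simp: r_def)
  have no_pole: "\<not> is_pole f w" if "w \<in> ball z r" for w
    using hol that not_is_pole_holomorphic[of "ball z r" w f] by auto
  have "inj_on f (ball z r)"
    using r0(2) no_pole by (auto simp: inj_on_def sphere_value_def r_def)
  then have "deriv f z \<noteq> 0"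
    using hol r by (intro holomorphic_injective_imp_regular) auto
  moreover have "\<forall>\<^sub>F w in nhds z. w \<in> ball z r"
    using r by (intro eventually_nhds_in_open) auto
  then have "\<forall>\<^sub>F w in nhds z. tamanoi_schwarzian n f w = tamanoi_schwarzian_finite n f w" for n
    by eventually_elim (simp add: tamanoi_schwarzian_def no_pole)
  ultimately show ?thesis using an that by blast
next
  case True
  define h where "h = (\<lambda>w. if w = z then 0 else inverse (f w))"
  have "f meromorphic_on {z}"
    using mero D by (auto simp: nicely_meromorphic_on_def intro: meromorphic_on_subset)
  then obtain r where r: "r > 0" and hol: "h holomorphic_on ball z r" and h': "deriv h z \<noteq> 0"
    and f: "\<And>w. w \<in> ball z r - {z} \<Longrightarrow> f analytic_on {w} \<and> f w \<noteq> 0"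
    using reciprocal_chart_at_pole[OF _ True univ] unfolding h_def by blast
  have h_an: "h analytic_on {w}" if "w \<in> ball z r" for w
    using hol that by (intro holomorphic_on_imp_analytic_at) auto
  have near: "\<forall>\<^sub>F w in nhds z. w \<in> ball z r"
    using r by (intro eventually_nhds_in_open) auto
  have at_pole: "tamanoi_schwarzian n f z = tamanoi_schwarzian_finite n h z" for n
  proof -
    have inv: "tamanoi_schwarzian_finite n (moebius_comp a b c d f) z = tamanoi_schwarzian_finite n h z"
      if "a * d - b * c \<noteq> 0" "c \<noteq> 0" for a b c d
    proof (rule tamanoi_schwarzian_finite_moebius_invariant)
      \<comment> \<open>\<open>(a f + b) / (c f + d) = (b / f + a) / (d / f + c)\<close>: the roles of \<open>0\<close> and \<open>\<infinity>\<close> are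
        exchanged, and \<open>c \<noteq> 0\<close> says that the composition is finite at the pole\<close>
      show "\<forall>\<^sub>F w in nhds z. moebius_comp a b c d f w = moebius b a d c (h w)"
        using near
      proof eventually_elim
        case (elim w)
        show ?case
        proof (cases "w = z")
          case True
          then show ?thesis
            using \<open>is_pole f z\<close> by (simp add: moebius_comp_def sphere_value_def h_def moebius_def)
        next
          case False
          then have "f w \<noteq> 0" "\<not> is_pole f w"
            using elim f[of w] analytic_at_imp_no_pole by auto
          then have "moebius_comp a b c d f w = (f w * (b * h w + a)) / (f w * (d * h w + c))"
            using False by (simp add: moebius_comp_def sphere_value_def h_def moebius_def algebra_simps)
          also have "\<dots> = moebius b a d c (h w)" using \<open>f w \<noteq> 0\<close> by (simp add: moebius_def)
          finally show ?thesis .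
        qed
      qed
      show "b * c - a * d \<noteq> 0" "d * h z + c \<noteq> 0" using that by (auto simp: h_def)
    qed (use h_an r in auto)
    have "(THE s. \<forall>a b c d. a * d - b * c \<noteq> 0 \<longrightarrow> c \<noteq> 0 \<longrightarrow>
             tamanoi_schwarzian_finite n (moebius_comp a b c d f) z = s) = tamanoi_schwarzian_finite n h z"
    proof (rule the_equality)
      fix s assume s: "\<forall>a b c d. a * d - b * c \<noteq> 0 \<longrightarrow> c \<noteq> 0 \<longrightarrow>
             tamanoi_schwarzian_finite n (moebius_comp a b c d f) z = s"
      show "s = tamanoi_schwarzian_finite n h z"
        using s[rule_format, of 0 0 1 1] inv[of 0 0 1 1] by simp
    qed (use inv in blast)
    then show ?thesis using True by (simp add: tamanoi_schwarzian_def)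
  qed
  have off_pole: "tamanoi_schwarzian n f w = tamanoi_schwarzian_finite n h w"
    if w: "w \<in> ball z r - {z}" for n w
  proof -
    have "\<forall>\<^sub>F u in nhds w. u \<in> ball z r - {z}"
      using w by (intro eventually_nhds_in_open) auto
    then have "\<forall>\<^sub>F u in nhds w. f u = moebius 0 1 1 0 (h u)"
      by eventually_elim (auto simp: h_def moebius_def field_simps)
    moreover have "1 * h w + 0 \<noteq> 0" using w f[OF w] by (auto simp: h_def)
    ultimately have "tamanoi_schwarzian_finite n f w = tamanoi_schwarzian_finite n h w"
      using h_an w by (intro tamanoi_schwarzian_finite_moebius_invariant[of h w 0 0 1 1]) auto
    then show ?thesis using f[OF w] analytic_at_imp_no_pole by (auto simp: tamanoi_schwarzian_def)
  qed
  have "\<forall>\<^sub>F w in nhds z. tamanoi_schwarzian n f w = tamanoi_schwarzian_finite n h w" for n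
    using near by eventually_elim (metis at_pole off_pole Diff_iff singletonD)
  moreover have "h analytic_on {z}" using h_an r by auto
  ultimately show ?thesis using h' that by blast
qed

theorem proposition2p1:
  fixes f :: "complex \<Rightarrow> complex" and D :: "complex set"
  assumes "open D" and "connected D"
    and "f nicely_meromorphic_on D" and "\<not> f constant_on D"
  shows "\<forall>n\<ge>3. \<forall>z\<in>D. locally_univalent_at f z \<longrightarrow>
    tamanoi_schwarzian (n - 1) f field_differentiable (at z) \<and>
    tamanoi_schwarzian n f z =
      deriv (tamanoi_schwarzian (n - 1) f) z +
      1 / 2 * tamanoi_schwarzian 2 f z *
        (\<Sum>k = 1..n - 1. of_nat (n choose k) *
           tamanoi_schwarzian (k - 1) f z * tamanoi_schwarzian (n - k - 1) f z)"
proof (intro allI impI ballI)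
  fix n :: nat and z
  assume n: "n \<ge> 3" and z: "z \<in> D" and univ: "locally_univalent_at f z"
  obtain g where g: "g analytic_on {z}" "deriv g z \<noteq> 0"
    and near: "\<And>m. \<forall>\<^sub>F w in nhds z. tamanoi_schwarzian m f w = tamanoi_schwarzian_finite m g w"
    using tamanoi_schwarzian_finite_chart[OF assms(3) z univ] by blast
  have at: "tamanoi_schwarzian m f z = tamanoi_schwarzian_finite m g z" for m
    using eventually_nhds_x_imp_x[OF near] .
  have deriv: "deriv (tamanoi_schwarzian (n - 1) f) z = deriv (tamanoi_schwarzian_finite (n - 1) g) z"
    by (rule deriv_cong_ev[OF near refl])
  have "tamanoi_schwarzian (n - 1) f field_differentiable (at z)"
    using tamanoi_schwarzian_finite_recurrence(1)[OF g, of n] n DERIV_cong_ev[OF refl near refl]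
    unfolding field_differentiable_def by fastforce
  moreover have "1 \<le> n" using n by simp
  note tamanoi_schwarzian_finite_recurrence(2)[OF g this]
  ultimately show "tamanoi_schwarzian (n - 1) f field_differentiable (at z) \<and>
    tamanoi_schwarzian n f z =
      deriv (tamanoi_schwarzian (n - 1) f) z +
      1 / 2 * tamanoi_schwarzian 2 f z *
        (\<Sum>k = 1..n - 1. of_nat (n choose k) *
           tamanoi_schwarzian (k - 1) f z * tamanoi_schwarzian (n - k - 1) f z)"
    unfolding at deriv by blast
qed

end
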